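(* Let $W\in L^1((0,1)^2)$ be a graphon with $W(x,y)=W(y,x)\ge0$ for all $(x,y)\in(0,1)^2$ and $\int_0^1W(x,y)\,dy\le1$ for a.e. $x\in(0,1)$. Let $\Phi:\mathbb{R}\to\mathbb{R}$ satisfy $\Phi(0)=0$, be locally Lipschitz continuous (Lipschitz on every bounded subset of $\mathbb{R}$), and let $M_1<M_2$ be constants such that $\Phi(M_2)\le0\le\Phi(M_1)$. Let $u$ be the unique classical solution on $[0,T_{max})$ of the graphon reaction--diffusion equation $\partial_tu=\mathcal{L}^Wu+\Phi(u)$ with initial condition $u(\cdot,0)=u_0\in L^\infty((0,1))$. If $$M_1\le u_0(x)\le M_2\qquad\text{for a.e. }x\in(0,1),$$ then for all $t\in[0,T_{max})$, $$M_1\le u(x,t)\le M_2\qquad\text{for a.e. }x\in(0,1).$$ Consequently, $u$ can be extended to a unique classical solution of the equation on $[0,T]$ for arbitrary $T>0$.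
   Context: The graphon diffusion operator is $\mathcal{L}^W u(x)=\int_0^1 W(x,y)\,(u(y)-u(x))\,dy$; under the stated hypotheses on $W$ it is a bounded linear operator on $L^\infty((0,1))$. $\Phi(u)$ denotes the pointwise composition $x\mapsto\Phi(u(x,t))$. A classical solution on an interval $J$ is $u\in C^1(J;L^\infty((0,1)))$ satisfying the equation as an identity in $L^\infty((0,1))$ for $t\in J$. $T_{max}\in(0,\infty]$ denotes the existence time of the unique classical solution in $L^\infty((0,1))$ for the data $u_0$ (with $\|u(\cdot,t)\|_\infty\to\infty$ as $t\to T_{max}$ if $T_{max}<\infty$). *)

theory Defs
  imports "HOL-Probability.Essential_Supremum"
begin

abbreviation leb01 :: "real measure"
  where "leb01 \<equiv> lebesgue_on {0<..<1}"

lemma emeasure_leb01: "emeasure leb01 (space leb01) \<noteq> 0"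
  by (simp add: emeasure_restrict_space)

subsection \<open>The Banach space of essentially bounded functions on the unit interval\<close>

definition ess_bounded :: "(real \<Rightarrow> real) \<Rightarrow> bool"
  where "ess_bounded f \<longleftrightarrow> f \<in> borel_measurable leb01 \<and> (\<exists>C. AE x in leb01. \<bar>f x\<bar> \<le> C)"

definition linf_rel :: "(real \<Rightarrow> real) \<Rightarrow> (real \<Rightarrow> real) \<Rightarrow> bool"
  where "linf_rel f g \<longleftrightarrow> ess_bounded f \<and> ess_bounded g \<and> (AE x in leb01. f x = g x)"

lemma ess_boundedI:
  "f \<in> borel_measurable leb01 \<Longrightarrow> AE x in leb01. \<bar>f x\<bar> \<le> C \<Longrightarrow> ess_bounded f"
  unfolding ess_bounded_def by blast

lemma ess_bounded_zero: "ess_bounded (\<lambda>_. 0)"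
  by (rule ess_boundedI[where C = 0]) auto

lemma ess_bounded_add:
  assumes "ess_bounded f" "ess_bounded g"
  shows "ess_bounded (\<lambda>x. f x + g x)"
proof -
  from assms obtain C D where "AE x in leb01. \<bar>f x\<bar> \<le> C" "AE x in leb01. \<bar>g x\<bar> \<le> D"
    unfolding ess_bounded_def by blast
  then have "AE x in leb01. \<bar>f x + g x\<bar> \<le> C + D"
    by eventually_elim linarith
  then show ?thesis
    using assms by (intro ess_boundedI) (auto simp: ess_bounded_def)
qed

lemma ess_bounded_scale:
  assumes "ess_bounded f"
  shows "ess_bounded (\<lambda>x. r * f x)"
proof -
  from assms obtain C where "AE x in leb01. \<bar>f x\<bar> \<le> C"
    unfolding ess_bounded_def by blast
  then have "AE x in leb01. \<bar>r * f x\<bar> \<le> \<bar>r\<bar> * C"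
    by eventually_elim (simp add: abs_mult mult_left_mono)
  then show ?thesis
    using assms by (intro ess_boundedI) (auto simp: ess_bounded_def)
qed

lemma ess_bounded_minus: "ess_bounded f \<Longrightarrow> ess_bounded (\<lambda>x. - f x)"
  using ess_bounded_scale[of f "-1"] by simp

lemma ess_bounded_diff:
  "ess_bounded f \<Longrightarrow> ess_bounded g \<Longrightarrow> ess_bounded (\<lambda>x. f x - g x)"
  using ess_bounded_add[OF _ ess_bounded_minus, of f g] by simp

lemma part_equivp_linf_rel: "part_equivp linf_rel"
proof (rule part_equivpI)
  show "\<exists>f. linf_rel f f"
    using ess_bounded_zero by (auto simp: linf_rel_def)
  show "symp linf_rel"
    by (auto simp: symp_def linf_rel_def eq_commute)
  show "transp linf_rel"
  proof (rule transpI)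
    fix f g h assume *: "linf_rel f g" "linf_rel g h"
    then have "AE x in leb01. f x = g x" "AE x in leb01. g x = h x"
      by (auto simp: linf_rel_def)
    then have "AE x in leb01. f x = h x"
      by eventually_elim simp
    with * show "linf_rel f h" by (auto simp: linf_rel_def)
  qed
qed

quotient_type linf = "real \<Rightarrow> real" / partial: linf_rel
  morphisms linf_fun Linf
  by (rule part_equivp_linf_rel)

text \<open>
  \<^term>\<open>Linf f\<close> is the class of \<^term>\<open>f\<close> modulo almost-everywhere equality and is meaningful
  only for essentially bounded \<^term>\<open>f\<close>; \<^term>\<open>linf_fun u\<close> is an arbitrarily chosen
  representative of \<^term>\<open>u\<close>.
\<close>

lemma ess_bounded_Linf_eq_iff:
  "ess_bounded f \<Longrightarrow> ess_bounded g \<Longrightarrow> Linf f = Linf g \<longleftrightarrow> (AE x in leb01. f x = g x)"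
  using Quotient3_rel[OF Quotient3_linf, of f g] by (auto simp: linf_rel_def)

lemma linf_fun: "ess_bounded (linf_fun u)" "Linf (linf_fun u) = u"
  using Quotient3_rep_reflp[OF Quotient3_linf, of u] Quotient3_abs_rep[OF Quotient3_linf, of u]
  by (auto simp: linf_rel_def)

lemma linf_fun_Linf: "ess_bounded f \<Longrightarrow> AE x in leb01. linf_fun (Linf f) x = f x"
  using ess_bounded_Linf_eq_iff linf_fun by blast

lemma ess_bounded_esssup:
  assumes "ess_bounded f"
  shows "\<exists>c\<ge>0. esssup leb01 (\<lambda>x. ereal \<bar>f x\<bar>) = ereal c"
proof -
  have m: "(\<lambda>x. ereal \<bar>f x\<bar>) \<in> borel_measurable leb01"
    using assms by (auto simp: ess_bounded_def)
  obtain C where "AE x in leb01. \<bar>f x\<bar> \<le> C"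
    using assms by (auto simp: ess_bounded_def)
  then have "esssup leb01 (\<lambda>x. ereal \<bar>f x\<bar>) \<le> ereal C"
    by (intro esssup_I m) auto
  moreover have "0 \<le> esssup leb01 (\<lambda>x. ereal \<bar>f x\<bar>)"
    using esssup_mono[of "\<lambda>_. 0::ereal" leb01 "\<lambda>x. ereal \<bar>f x\<bar>"]
    by (simp add: esssup_const[OF emeasure_leb01])
  ultimately show ?thesis
    by (cases "esssup leb01 (\<lambda>x. ereal \<bar>f x\<bar>)") auto
qed

lemma esssup_le_iff:
  assumes "ess_bounded f"
  shows "real_of_ereal (esssup leb01 (\<lambda>x. ereal \<bar>f x\<bar>)) \<le> C \<longleftrightarrow> (AE x in leb01. \<bar>f x\<bar> \<le> C)"
proof -
  obtain c where c: "esssup leb01 (\<lambda>x. ereal \<bar>f x\<bar>) = ereal c"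
    using ess_bounded_esssup[OF assms] by blast
  have m: "(\<lambda>x. ereal \<bar>f x\<bar>) \<in> borel_measurable leb01"
    using assms by (auto simp: ess_bounded_def)
  have "AE x in leb01. ereal \<bar>f x\<bar> \<le> ereal c"
    using esssup_AE[of "\<lambda>x. ereal \<bar>f x\<bar>" leb01] unfolding c .
  then have *: "AE x in leb01. \<bar>f x\<bar> \<le> c" by simp
  show ?thesis
  proof
    assume "real_of_ereal (esssup leb01 (\<lambda>x. ereal \<bar>f x\<bar>)) \<le> C"
    then have "c \<le> C" by (simp add: c)
    with * show "AE x in leb01. \<bar>f x\<bar> \<le> C" by (auto elim: eventually_mono)
  next
    assume "AE x in leb01. \<bar>f x\<bar> \<le> C"
    then have "esssup leb01 (\<lambda>x. ereal \<bar>f x\<bar>) \<le> ereal C"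
      by (intro esssup_I m) auto
    then show "real_of_ereal (esssup leb01 (\<lambda>x. ereal \<bar>f x\<bar>)) \<le> C"
      by (simp add: c)
  qed
qed

instantiation linf :: real_normed_vector
begin

lift_definition zero_linf :: linf is "\<lambda>_. 0"
  by (auto simp: linf_rel_def ess_bounded_zero)

lift_definition plus_linf :: "linf \<Rightarrow> linf \<Rightarrow> linf" is "\<lambda>f g x. f x + g x"
  by (auto simp: linf_rel_def ess_bounded_add)

lift_definition minus_linf :: "linf \<Rightarrow> linf \<Rightarrow> linf" is "\<lambda>f g x. f x - g x"
  by (auto simp: linf_rel_def ess_bounded_diff)

lift_definition uminus_linf :: "linf \<Rightarrow> linf" is "\<lambda>f x. - f x"
  by (auto simp: linf_rel_def ess_bounded_minus)

lift_definition scaleR_linf :: "real \<Rightarrow> linf \<Rightarrow> linf" is "\<lambda>r f x. r * f x"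
  by (auto simp: linf_rel_def ess_bounded_scale)

lift_definition norm_linf :: "linf \<Rightarrow> real"
  is "\<lambda>f. real_of_ereal (esssup leb01 (\<lambda>x. ereal \<bar>f x\<bar>))"
  by (intro arg_cong[where f = real_of_ereal] esssup_AE_cong)
     (auto simp: linf_rel_def ess_bounded_def)

definition dist_linf :: "linf \<Rightarrow> linf \<Rightarrow> real"
  where "dist_linf u v = norm (u - v)"

definition sgn_linf :: "linf \<Rightarrow> linf"
  where "sgn_linf u = inverse (norm u) *\<^sub>R u"

definition uniformity_linf :: "(linf \<times> linf) filter"
  where "uniformity_linf = (INF e\<in>{0<..}. principal {(u, v). dist u v < e})"

definition open_linf :: "linf set \<Rightarrow> bool"
  where "open_linf S = (\<forall>u\<in>S. \<forall>\<^sub>F (v, w) in uniformity. v = u \<longrightarrow> w \<in> S)"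

lemma norm_linf_le_iff_Linf:
  "ess_bounded f \<Longrightarrow> norm (Linf f) \<le> C \<longleftrightarrow> (AE x in leb01. \<bar>f x\<bar> \<le> C)"
  by (subst norm_linf.abs_eq) (auto simp: linf_rel_def esssup_le_iff)

lemma norm_linf_AE: "ess_bounded f \<Longrightarrow> AE x in leb01. \<bar>f x\<bar> \<le> norm (Linf f)"
  using norm_linf_le_iff_Linf[of f "norm (Linf f)"] by simp

lemma norm_linf_nonneg: "0 \<le> norm (u :: linf)"
  by transfer (use ess_bounded_esssup in \<open>force simp: linf_rel_def\<close>)

instance
proof
  fix u v w :: linf and r s :: real
  show "u + v + w = u + (v + w)"
    by transfer (auto simp: linf_rel_def add.assoc intro!: ess_bounded_add)
  show "u + v = v + u"
    by transfer (auto simp: linf_rel_def add.commute intro!: ess_bounded_add)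
  show "0 + u = u"
    by transfer (auto simp: linf_rel_def)
  show "- u + u = 0"
    by transfer (auto simp: linf_rel_def ess_bounded_zero)
  show "u - v = u + - v"
    by transfer (auto simp: linf_rel_def intro!: ess_bounded_diff)
  show "r *\<^sub>R (u + v) = r *\<^sub>R u + r *\<^sub>R v"
    by transfer (auto simp: linf_rel_def distrib_left intro!: ess_bounded_add ess_bounded_scale)
  show "(r + s) *\<^sub>R u = r *\<^sub>R u + s *\<^sub>R u"
    by transfer (auto simp: linf_rel_def distrib_right intro!: ess_bounded_add ess_bounded_scale)
  show "r *\<^sub>R s *\<^sub>R u = (r * s) *\<^sub>R u"
    by transfer (auto simp: linf_rel_def mult.assoc intro!: ess_bounded_scale)
  show "1 *\<^sub>R u = u"
    by transfer (auto simp: linf_rel_def)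
  show "dist u v = norm (u - v)" by (rule dist_linf_def)
  show "sgn u = inverse (norm u) *\<^sub>R u" by (rule sgn_linf_def)
  show "uniformity = (INF e\<in>{0<..}. principal {(u :: linf, v). dist u v < e})"
    by (rule uniformity_linf_def)
  show "open S \<longleftrightarrow> (\<forall>u\<in>S. \<forall>\<^sub>F (v, w) in uniformity. v = u \<longrightarrow> w \<in> S)" for S :: "linf set"
    by (rule open_linf_def)
  obtain f g where f: "ess_bounded f" "u = Linf f" and g: "ess_bounded g" "v = Linf g"
    by (metis linf_fun)
  show "norm u = 0 \<longleftrightarrow> u = 0"
  proof -
    have "norm u = 0 \<longleftrightarrow> norm u \<le> 0" using norm_linf_nonneg[of u] by linarith
    also have "\<dots> \<longleftrightarrow> u = 0"
      using f ess_bounded_zero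
      by (simp add: norm_linf_le_iff_Linf zero_linf_def ess_bounded_Linf_eq_iff)
    finally show ?thesis .
  qed
  have "AE x in leb01. \<bar>f x + g x\<bar> \<le> norm u + norm v"
    using norm_linf_AE[OF f(1)] norm_linf_AE[OF g(1)] unfolding f g
    by eventually_elim linarith
  then show "norm (u + v) \<le> norm u + norm v"
    using f g ess_bounded_add[OF f(1) g(1)]
    by (simp add: plus_linf.abs_eq linf_rel_def norm_linf_le_iff_Linf)
  have le: "norm (r *\<^sub>R u) \<le> \<bar>r\<bar> * norm u" for r and u :: linf
  proof -
    obtain f where f: "ess_bounded f" "u = Linf f" by (metis linf_fun)
    have "AE x in leb01. \<bar>r * f x\<bar> \<le> \<bar>r\<bar> * norm u"
      using norm_linf_AE[OF f(1)] unfolding f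
      by eventually_elim (simp add: abs_mult mult_left_mono)
    then show ?thesis
      using f ess_bounded_scale[OF f(1)]
      by (simp add: scaleR_linf.abs_eq linf_rel_def norm_linf_le_iff_Linf)
  qed
  show "norm (r *\<^sub>R u) = \<bar>r\<bar> * norm u"
  proof (cases "r = 0")
    case True
    then show ?thesis using le[of r u] norm_linf_nonneg[of "r *\<^sub>R u"] by simp
  next
    case False
    have "inverse r *\<^sub>R r *\<^sub>R u = u"
      using False f by (simp add: scaleR_linf.abs_eq linf_rel_def ess_bounded_scale mult.assoc[symmetric])
    then have "norm u \<le> \<bar>inverse r\<bar> * norm (r *\<^sub>R u)"
      using le[of "inverse r" "r *\<^sub>R u"] by simp
    then have "\<bar>r\<bar> * norm u \<le> norm (r *\<^sub>R u)"
      using False by (simp add: abs_inverse field_simps)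
    with le[of r u] show ?thesis by simp
  qed
qed

end

instance linf :: banach
proof
  fix u :: "nat \<Rightarrow> linf" assume "Cauchy u"
  define f where "f = (\<lambda>n. linf_fun (u n))"
  have f: "ess_bounded (f n)" "Linf (f n) = u n" for n
    by (simp_all add: f_def linf_fun)
  have "AE x in leb01. \<bar>f m x - f n x\<bar> \<le> dist (u m) (u n)" for m n
    using norm_linf_AE[OF ess_bounded_diff[OF f(1)[of m] f(1)[of n]]] f
    by (simp add: dist_norm minus_linf.abs_eq linf_rel_def flip: f(2))
  then have ae: "AE x in leb01. \<forall>m n. \<bar>f m x - f n x\<bar> \<le> dist (u m) (u n)"
    by (simp add: AE_all_countable)
  define h where "h = (\<lambda>x. lim (\<lambda>n. f n x))"
  have h_meas: "h \<in> borel_measurable leb01"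
    unfolding h_def using f(1) by (intro borel_measurable_lim_metric) (auto simp: ess_bounded_def)
  have close: "AE x in leb01. \<bar>f n x - h x\<bar> \<le> e" if N: "\<And>m n. m \<ge> N \<Longrightarrow> n \<ge> N \<Longrightarrow> dist (u m) (u n) < e" and n: "n \<ge> N" for e N n
    using ae
  proof eventually_elim
    case (elim x)
    have "Cauchy (\<lambda>n. f n x)"
    proof (rule metric_CauchyI)
      fix e :: real assume "e > 0"
      then obtain M where "\<And>m n. m \<ge> M \<Longrightarrow> n \<ge> M \<Longrightarrow> dist (u m) (u n) < e"
        using metric_CauchyD[OF \<open>Cauchy u\<close>] by blast
      with elim show "\<exists>M. \<forall>m\<ge>M. \<forall>n\<ge>M. dist (f m x) (f n x) < e"
        unfolding dist_real_def by (meson le_less_trans)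
    qed
    then have lim: "(\<lambda>m. f m x) \<longlonglongrightarrow> h x"
      by (simp add: h_def Cauchy_convergent_iff convergent_LIMSEQ_iff)
    show "\<bar>f n x - h x\<bar> \<le> e"
    proof (rule LIMSEQ_le_const2)
      show "(\<lambda>m. \<bar>f n x - f m x\<bar>) \<longlonglongrightarrow> \<bar>f n x - h x\<bar>"
        by (intro tendsto_intros lim)
      show "\<exists>M. \<forall>m\<ge>M. \<bar>f n x - f m x\<bar> \<le> e"
        using elim N n by (meson le_less_trans less_imp_le)
    qed
  qed
  have h: "ess_bounded h"
  proof -
    obtain N where N: "\<And>m n. m \<ge> N \<Longrightarrow> n \<ge> N \<Longrightarrow> dist (u m) (u n) < 1"
      using metric_CauchyD[OF \<open>Cauchy u\<close>, of 1] by auto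
    obtain C where "AE x in leb01. \<bar>f N x\<bar> \<le> C" using f(1)[of N] by (auto simp: ess_bounded_def)
    moreover have "AE x in leb01. \<bar>f N x - h x\<bar> \<le> 1"
      by (rule close[of N 1 N, OF N]) auto
    ultimately have "AE x in leb01. \<bar>h x\<bar> \<le> C + 1"
      by eventually_elim linarith
    with h_meas show ?thesis by (rule ess_boundedI)
  qed
  have "u \<longlonglongrightarrow> Linf h"
  proof (rule metric_LIMSEQ_I)
    fix e :: real assume "e > 0"
    then obtain N where N: "\<And>m n. m \<ge> N \<Longrightarrow> n \<ge> N \<Longrightarrow> dist (u m) (u n) < e / 2"
      using metric_CauchyD[OF \<open>Cauchy u\<close>, of "e / 2"] by auto
    have "dist (u n) (Linf h) < e" if "n \<ge> N" for n
    proof -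
      have "norm (Linf (\<lambda>x. f n x - h x)) \<le> e / 2"
        using close[of N "e / 2" n, OF N] that norm_linf_le_iff_Linf[OF ess_bounded_diff[OF f(1) h]]
        by blast
      then have "dist (u n) (Linf h) \<le> e / 2"
        using f h by (simp add: dist_norm minus_linf.abs_eq linf_rel_def flip: f(2))
      then show ?thesis using \<open>e > 0\<close> by linarith
    qed
    then show "\<exists>N. \<forall>n\<ge>N. dist (u n) (Linf h) < e" by blast
  qed
  then show "convergent u" by (rule convergentI)
qed

subsection \<open>The graphon reaction--diffusion equation\<close>

definition graphon_diffusion :: "(real \<Rightarrow> real \<Rightarrow> real) \<Rightarrow> linf \<Rightarrow> linf"
  where "graphon_diffusion W u =
    Linf (\<lambda>x. LINT y|leb01. W x y * (linf_fun u y - linf_fun u x))"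

definition reaction :: "(real \<Rightarrow> real) \<Rightarrow> linf \<Rightarrow> linf"
  where "reaction \<Phi> u = Linf (\<lambda>x. \<Phi> (linf_fun u x))"

lemma AE_leb01: "(AE x in leb01. P x) \<longleftrightarrow> (AE x in lborel. x \<in> {0<..<1} \<longrightarrow> P x)"
  by (simp add: AE_restrict_space_iff AE_completion_iff)

lemma meas_leb01:
  fixes f :: "real \<Rightarrow> real"
  shows "f \<in> borel_measurable leb01 \<longleftrightarrow> (\<lambda>x. indicator {0<..<1} x * f x) \<in> borel_measurable lebesgue"
  using borel_measurable_restrict_space_iff[of "{0<..<1}" lebesgue f] by simp

text \<open>
  Under the hypotheses on the kernel and the nonlinearity, the functions in
  \<^term>\<open>graphon_diffusion\<close> and \<^term>\<open>reaction\<close> are essentially bounded, so the classes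
  formed there are meaningful.
\<close>

lemma ess_bounded_graphon_diffusion:
  fixes W :: "real \<Rightarrow> real \<Rightarrow> real"
  assumes W: "integrable (lebesgue_on ({0<..<1} \<times> {0<..<1})) (\<lambda>(x, y). W x y)"
    and nonneg: "\<And>x y. x \<in> {0<..<1} \<Longrightarrow> y \<in> {0<..<1} \<Longrightarrow> 0 \<le> W x y"
    and deg: "AE x in leb01. (LINT y|leb01. W x y) \<le> 1"
    and f: "ess_bounded f"
  shows "ess_bounded (\<lambda>x. LINT y|leb01. W x y * (f y - f x))"
proof -
  let ?I = "{0<..<1::real}"
  define g where "g = (\<lambda>p. indicator (?I \<times> ?I) p * W (fst p) (snd p))"
  have "integrable lebesgue g"
    using W unfolding g_def
    by (subst (asm) integrable_restrict_space) (auto simp: case_prod_unfold borel_open open_Times intro!: sets_completionI_sets)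
  then have g_int: "integrable (completion lborel) g" .
  then obtain g' where g': "g' \<in> borel_measurable lborel" "AE p in lborel. g p = g' p"
    using completion_ex_borel_measurable_real[of g lborel] by auto
  have "integrable (completion lborel) g'"
    using g' by (intro integrable_cong_AE_imp[OF g_int] AE_completion measurable_completion) auto
  then have g'_int: "integrable (lborel \<Otimes>\<^sub>M lborel) g'"
    using g'(1) by (simp add: integrable_completion lborel_prod)
  have g'_meas [measurable]: "g' \<in> borel_measurable (lborel \<Otimes>\<^sub>M lborel)"
    using g'(1) unfolding lborel_prod .
  have sec_eq: "AE x in lborel. AE y in lborel. g (x, y) = g' (x, y)"
    using g'(2) unfolding lborel_prod[symmetric] by (rule lborel_pair.AE_pair)
  have sec_int: "AE x in lborel. integrable lborel (\<lambda>y. g' (x, y))"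
    by (rule lborel_pair.AE_integrable_fst'[OF g'_int])
  obtain C where C: "AE x in leb01. \<bar>f x\<bar> \<le> C" using f by (auto simp: ess_bounded_def)
  define h where "h = (\<lambda>x. indicator ?I x * f x)"
  have h_meas: "h \<in> borel_measurable lebesgue"
    using f by (simp add: h_def ess_bounded_def meas_leb01)
  then obtain h' where h' [measurable]: "h' \<in> borel_measurable lborel" and hh': "AE x in lborel. h x = h' x"
    using completion_ex_borel_measurable_real[of h lborel] by auto
  define G where "G = (\<lambda>x. LINT y|lborel. g' (x, y) * (h' y - h' x))"
  have G_meas: "G \<in> borel_measurable lborel"
    unfolding G_def by measurable
  let ?F = "\<lambda>x. LINT y|leb01. W x y * (f y - f x)"
  have lint: "(LINT y|leb01. k y) = (LINT y|lebesgue. indicator ?I y * k y)" for k :: "real \<Rightarrow> real"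
    by (subst integral_restrict_space) auto
  have *: "AE x in lborel. x \<in> ?I \<longrightarrow> ?F x = G x \<and> \<bar>?F x\<bar> \<le> 2 * C"
    using sec_eq sec_int hh' C[unfolded AE_leb01] deg[unfolded AE_leb01]
  proof eventually_elim
    case (elim x)
    show ?case
    proof
      assume x: "x \<in> ?I"
      have sec_meas [measurable]: "(\<lambda>y. g' (x, y)) \<in> borel_measurable lborel"
        using elim(2) by auto
      have ae1: "AE y in lborel. g' (x, y) = indicator ?I y * W x y"
        using elim(1) by eventually_elim (use x in \<open>auto simp: g_def indicator_def\<close>)
      have ae2: "AE y in lborel. g' (x, y) * (h' y - h' x) = indicator ?I y * (W x y * (f y - f x))"
        using ae1 hh' by eventually_elim (use x elim(3) in \<open>auto simp: h_def indicator_def\<close>)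
      have i: "integral\<^sup>L lebesgue l = integral\<^sup>L lborel k"
        if k: "k \<in> borel_measurable lborel" and kl: "AE y in lborel. k y = l y" for k l :: "real \<Rightarrow> real"
      proof -
        have "k \<in> borel_measurable lebesgue" using k by (rule measurable_completion)
        moreover have ae: "AE y in lebesgue. k y = l y" using kl by (rule AE_completion)
        ultimately have "l \<in> borel_measurable lebesgue" by (rule borel_measurable_AE)
        then have "integral\<^sup>L lebesgue l = integral\<^sup>L lebesgue k"
          using ae \<open>k \<in> borel_measurable lebesgue\<close>
          by (intro integral_cong_AE) (auto elim: eventually_mono)
        then show ?thesis using k by (simp add: integral_completion)
      qed
      have F: "?F x = G x"
        unfolding lint G_def by (rule i) (use ae2 in auto)
      have d: "(LINT y|lborel. g' (x, y)) \<le> 1"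
        using elim(5) x i[OF sec_meas ae1] unfolding lint by simp
      have "AE y in lborel. norm (g' (x, y) * (h' y - h' x)) \<le> 2 * C * g' (x, y)"
        using ae1 ae2 C[unfolded AE_leb01]
      proof eventually_elim
        case e: (elim y)
        show ?case
        proof (cases "y \<in> ?I")
          case True
          then have "\<bar>f y - f x\<bar> \<le> 2 * C" using e elim(4) x by auto
          then have "W x y * \<bar>f y - f x\<bar> \<le> W x y * (2 * C)"
            using nonneg[OF x True] by (rule mult_left_mono)
          moreover have "norm (g' (x, y) * (h' y - h' x)) = W x y * \<bar>f y - f x\<bar>"
            using e(2) True nonneg[OF x True] by (simp add: abs_mult)
          moreover have "g' (x, y) = W x y" using e(1) True by simp
          ultimately show ?thesis by (simp add: mult.commute)
        qed (use e in auto)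
      qed
      note bd = this
      have int: "integrable lborel (\<lambda>y. 2 * C * g' (x, y))" using elim(2) by simp
      have int': "integrable lborel (\<lambda>y. g' (x, y) * (h' y - h' x))"
        using bd by (intro Bochner_Integration.integrable_bound[OF int])
          (auto intro!: borel_measurable_times elim!: eventually_mono)
      have "norm (G x) \<le> (LINT y|lborel. norm (g' (x, y) * (h' y - h' x)))"
        unfolding G_def by (rule integral_norm_bound)
      also have "\<dots> \<le> (LINT y|lborel. 2 * C * g' (x, y))"
        using int int' bd by (intro integral_mono_AE) auto
      also have "\<dots> = 2 * C * (LINT y|lborel. g' (x, y))" by simp
      also have "\<dots> \<le> 2 * C * 1"
        using d elim(4) x by (intro mult_left_mono) auto
      finally show "?F x = G x \<and> \<bar>?F x\<bar> \<le> 2 * C" using F by simp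
    qed
  qed
  show ?thesis
  proof (rule ess_boundedI)
    show "AE x in leb01. \<bar>?F x\<bar> \<le> 2 * C"
      using * unfolding AE_leb01 by (auto elim: eventually_mono)
    have "(\<lambda>x. indicator ?I x * G x) \<in> borel_measurable lebesgue"
      using G_meas by (intro measurable_completion) auto
    moreover have "AE x in lebesgue. indicator ?I x * G x = indicator ?I x * ?F x"
      using * by (intro AE_completion) (auto simp: indicator_def elim!: eventually_mono)
    ultimately show "?F \<in> borel_measurable leb01"
      unfolding meas_leb01 by (rule borel_measurable_AE)
  qed
qed

lemma ess_bounded_reaction:
  assumes \<Phi>: "\<And>B. bounded B \<Longrightarrow> \<exists>K. K-lipschitz_on B \<Phi>" and f: "ess_bounded f"
  shows "ess_bounded (\<lambda>x. \<Phi> (f x))"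
proof -
  obtain C where C: "AE x in leb01. \<bar>f x\<bar> \<le> C" using f by (auto simp: ess_bounded_def)
  obtain K where K: "K-lipschitz_on {-\<bar>C\<bar>..\<bar>C\<bar>} \<Phi>" using \<Phi>[of "{-\<bar>C\<bar>..\<bar>C\<bar>}"] by auto
  have "continuous_on UNIV \<Phi>"
    unfolding continuous_on_eq_continuous_at[OF open_UNIV]
  proof
    fix x :: real
    obtain L where "L-lipschitz_on (ball x 1) \<Phi>" using \<Phi>[of "ball x 1"] by auto
    then have "continuous_on (ball x 1) \<Phi>" by (rule lipschitz_on_continuous_on)
    then show "isCont \<Phi> x" by (simp add: continuous_on_eq_continuous_at)
  qed
  then have "\<Phi> \<in> borel_measurable borel" by (rule borel_measurable_continuous_onI)
  then have m: "(\<lambda>x. \<Phi> (f x)) \<in> borel_measurable leb01"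
    using f by (auto simp: ess_bounded_def)
  have "AE x in leb01. \<bar>\<Phi> (f x)\<bar> \<le> \<bar>\<Phi> 0\<bar> + K * \<bar>C\<bar>"
    using C
  proof eventually_elim
    case (elim x)
    have "dist (\<Phi> (f x)) (\<Phi> 0) \<le> K * dist (f x) 0"
      using elim by (intro lipschitz_onD[OF K]) auto
    also have "\<dots> \<le> K * \<bar>C\<bar>"
      using elim lipschitz_on_nonneg[OF K] by (intro mult_left_mono) (auto simp: dist_real_def)
    finally show ?case by (simp add: dist_real_def)
  qed
  with m show ?thesis by (rule ess_boundedI)
qed

text \<open>
  Continuous differentiability refers to the norm of \<^typ>\<open>linf\<close>; at an end point of the interval
  that belongs to it the derivative is one-sided.
\<close>

definition classical_solution ::
  "(real \<Rightarrow> real \<Rightarrow> real) \<Rightarrow> (real \<Rightarrow> real) \<Rightarrow> real set \<Rightarrow> (real \<Rightarrow> linf) \<Rightarrow> bool"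
  where "classical_solution W \<Phi> J u \<longleftrightarrow>
    (\<exists>u'. continuous_on J u' \<and>
      (\<forall>t\<in>J. (u has_vector_derivative u' t) (at t within J)) \<and>
      (\<forall>t\<in>J. u' t = graphon_diffusion W (u t) + reaction \<Phi> (u t)))"

text \<open>
  Maximality is expressed by the supremum of the lengths of solution intervals; blow-up of the norm
  at a finite existence time is not part of the definition.
\<close>

definition existence_time ::
  "(real \<Rightarrow> real \<Rightarrow> real) \<Rightarrow> (real \<Rightarrow> real) \<Rightarrow> linf \<Rightarrow> ereal"
  where "existence_time W \<Phi> u0 =
    Sup {ereal T |T. 0 < T \<and> (\<exists>u. classical_solution W \<Phi> {0..<T} u \<and> u 0 = u0)}"

end

(*
The order interval M1 <= u <= M2 is a closed ball around a constant c in L^infinity, of radius r,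
say. With F(u) = L^W u + Phi(u) and mu large, F(w) + mu (w - c) has norm at most mu r for every w
in the ball: at M1 and M2 the signs of Phi help, the averaging term is controlled by the degree
bound, and the loss in between is absorbed by mu. Composing mu w + F(w) with the pointwise
truncation P to [M1, M2] gives the globally Lipschitz equation v' = - mu v + mu P(v) + F(P(v)),
which has a global solution. Since exp(mu t) (v - c) has derivative of norm at most
mu r exp(mu t), v never leaves the ball; there P is the identity, so v solves the original
equation. Uniqueness for the locally Lipschitz field F identifies v with u.
*)

theory Submission
  imports Defs
begin

section \<open>Ordinary differential equations in normed spaces\<close>

text \<open>Mean value inequality with majorant \<open>c * exp (a * t)\<close>, whose derivative is
  the assumed bound and whose increment over \<open>{0..b}\<close> is the right-hand side. It serves
  uniqueness, the Picard contraction and the invariance of balls.\<close>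

lemma exp_weighted_mean_value:
  fixes f :: "real \<Rightarrow> 'a::real_normed_vector"
  assumes "0 \<le> b"
    and f: "\<And>t. t \<in> {0..b} \<Longrightarrow> (f has_vector_derivative f' t) (at t within {0..b})"
    and le: "\<And>t. t \<in> {0..b} \<Longrightarrow> norm (f' t) \<le> c * a * exp (a * t)"
  shows "norm (f b - f 0) \<le> c * (exp (a * b) - 1)"
proof (cases "b = 0")
  case False
  with \<open>0 \<le> b\<close> have "0 < b" by simp
  have "norm (f b - f 0) \<le> c * exp (a * b) - c * exp (a * 0)"
  proof (rule differentiable_bound_general[OF \<open>0 < b\<close>])
    show "continuous_on {0..b} f"
      using f by (intro continuous_on_vector_derivative)
    show "continuous_on {0..b} (\<lambda>t. c * exp (a * t))"
      by (intro continuous_intros)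
    show "(f has_vector_derivative f' t) (at t)" if "0 < t" "t < b" for t
      using f[of t] that by (simp add: at_within_Icc_at)
    show "((\<lambda>t. c * exp (a * t)) has_vector_derivative c * a * exp (a * t)) (at t)" for t
      by (auto intro!: derivative_eq_intros simp flip: has_real_derivative_iff_has_vector_derivative)
    show "norm (f' t) \<le> c * a * exp (a * t)" if "0 < t" "t < b" for t
      using le[of t] that by simp
  qed
  then show ?thesis by (simp add: algebra_simps)
qed simp

text \<open>In place of Gronwall's inequality, the distance of the two solutions is weighted by a
  decaying exponential. The mean value bound shows that the maximum of the weighted distance is at
  most half of itself, hence zero.\<close>

lemma lipschitz_ode_unique:
  fixes F :: "'a::real_normed_vector \<Rightarrow> 'a"
  assumes F: "K-lipschitz_on B F"
    and v: "\<And>t. t \<in> {0..T} \<Longrightarrow> (v has_vector_derivative F (v t)) (at t within {0..T})"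
    and w: "\<And>t. t \<in> {0..T} \<Longrightarrow> (w has_vector_derivative F (w t)) (at t within {0..T})"
    and B: "v ` {0..T} \<subseteq> B" "w ` {0..T} \<subseteq> B"
    and init: "v 0 = w 0" and t: "t \<in> {0..T}"
  shows "v t = w t"
proof -
  \<comment> \<open>The factor 2 makes the growth bound \<open>K + 1\<close> only half of the
    exponential rate; this half is the gain in the estimate below.\<close>
  define a where "a = 2 * (K + 1)"
  have K: "0 \<le> K" using F by (rule lipschitz_on_nonneg)
  define g where "g = (\<lambda>t. exp (- a * t) * norm (v t - w t))"
  have "continuous_on {0..T} g"
    unfolding g_def using v w
    by (intro continuous_intros continuous_on_vector_derivative)
  then obtain s where s: "s \<in> {0..T}" and max: "\<And>t. t \<in> {0..T} \<Longrightarrow> g t \<le> g s"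
    using continuous_attains_sup[of "{0..T}" g] t by auto
  have norm_eq: "norm (v t - w t) = g t * exp (a * t)" for t
    by (simp add: g_def exp_minus field_simps)
  have g0: "0 \<le> g t" for t by (simp add: g_def)
  have "norm ((v s - w s) - (v 0 - w 0)) \<le> g s / 2 * (exp (a * s) - 1)"
  proof (rule exp_weighted_mean_value[where f = "\<lambda>t. v t - w t" and f' = "\<lambda>t. F (v t) - F (w t)"])
    show "0 \<le> s" using s by simp
    fix t assume "t \<in> {0..s}"
    then have t: "t \<in> {0..T}" using s by simp
    show "((\<lambda>t. v t - w t) has_vector_derivative F (v t) - F (w t)) (at t within {0..s})"
      using s by (intro has_vector_derivative_diff
          has_vector_derivative_within_subset[OF v[OF t]]
          has_vector_derivative_within_subset[OF w[OF t]]) auto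
    have "norm (F (v t) - F (w t)) \<le> K * norm (v t - w t)"
      using B t by (intro lipschitz_on_normD[OF F]) auto
    also have "\<dots> \<le> (K + 1) * (g s * exp (a * t))"
      unfolding norm_eq using K g0 max[OF t] by (intro mult_mono) auto
    finally show "norm (F (v t) - F (w t)) \<le> g s / 2 * a * exp (a * t)"
      by (simp add: a_def algebra_simps)
  qed
  then have "g s * exp (a * s) \<le> g s / 2 * (exp (a * s) - 1)"
    using init by (simp add: norm_eq)
  also have "\<dots> \<le> g s / 2 * exp (a * s)" using g0[of s] by (intro mult_left_mono) auto
  finally have "g s * exp (a * s) \<le> 0" by simp
  then have "g s \<le> 0" by (simp add: mult_le_0_iff)
  with max[OF t] g0[of t] have "g t = 0" by linarith
  then show ?thesis by (simp add: g_def)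
qed

text \<open>
  The Picard operator is a contraction on all of the given interval once solutions are
  rescaled by a decaying exponential.
\<close>

lemma lipschitz_ode_exists:
  fixes G :: "'a::banach \<Rightarrow> 'a"
  assumes G: "K-lipschitz_on UNIV G" and "0 \<le> T"
  obtains v where "v 0 = v0"
    and "\<And>t. t \<in> {0..T} \<Longrightarrow> (v has_vector_derivative G (v t)) (at t within {0..T})"
proof -
  define a where "a = 2 * (K + 1)"
  have K: "0 \<le> K" using G by (rule lipschitz_on_nonneg)
  have G_cont: "continuous_on A G" for A
    using lipschitz_on_continuous_on[OF G] by (rule continuous_on_subset) simp
  \<comment> \<open>Clamping time to \<open>{0..T}\<close> extends functions on the interval to
    bounded continuous functions on the whole line, which form a complete space.\<close>
  define \<tau> where "\<tau> = (\<lambda>t. max 0 (min T t))"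
  have \<tau>: "\<tau> t \<in> {0..T}" and \<tau>_id: "t \<in> {0..T} \<Longrightarrow> \<tau> t = t" for t
    using \<open>0 \<le> T\<close> by (auto simp: \<tau>_def)
  \<comment> \<open>The unknown \<open>w\<close> is the rescaled solution:
    \<open>exp (a * s) *\<^sub>R w s\<close> stands for the solution at time \<open>s\<close>, and
    \<open>g w\<close> is the integrand of its Picard iterate \<open>S w\<close>.\<close>
  define g where "g = (\<lambda>w :: real \<Rightarrow>\<^sub>C 'a. \<lambda>s. G (exp (a * s) *\<^sub>R w s))"
  have g_cont: "continuous_on A (g w)" for A w
    unfolding g_def by (intro continuous_on_compose2[OF G_cont[of UNIV]] continuous_intros) auto
  define S where "S = (\<lambda>w t. v0 + integral {0..t} (g w))"
  have S_deriv: "(S w has_vector_derivative g w t) (at t within {0..T})" if "t \<in> {0..T}" for w t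
    unfolding S_def
    by (rule derivative_eq_intros integral_has_vector_derivative[OF g_cont that] refl)+ simp
  \<comment> \<open>The Picard iterate, scaled back and extended constantly beyond the
    interval.\<close>
  define H where "H = (\<lambda>w t. exp (- a * \<tau> t) *\<^sub>R S w (\<tau> t))"
  have "continuous_on {0..T} (\<lambda>t. exp (- a * t) *\<^sub>R S w t)" for w
    using S_deriv by (intro continuous_intros continuous_on_vector_derivative)
  note cont = this
  have H: "H w \<in> bcontfun" for w
  proof -
    have "continuous_on UNIV (H w)"
      unfolding H_def by (intro continuous_on_compose2[OF cont[of w], of UNIV \<tau>])
        (use \<tau> in \<open>auto simp: \<tau>_def intro!: continuous_intros\<close>)
    moreover have "bounded (range (H w))"
    proof (rule bounded_subset)
      show "bounded ((\<lambda>t. exp (- a * t) *\<^sub>R S w t) ` {0..T})"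
        by (intro compact_imp_bounded compact_continuous_image cont) auto
    qed (use \<tau> in \<open>auto simp: H_def\<close>)
    ultimately show ?thesis by (simp add: bcontfun_def)
  qed
  \<comment> \<open>The integrands differ by at most \<open>(K + 1) * exp (a * s)\<close> times the
    distance; integration divides by \<open>a = 2 * (K + 1)\<close>, and the outer factor
    \<open>exp (- a * t)\<close> cancels the remaining exponential, leaving 1/2.\<close>
  have contraction: "dist (Bcontfun (H w)) (Bcontfun (H z)) \<le> 1/2 * dist w z" for w z
  proof (rule dist_bound)
    fix t
    let ?t = "\<tau> t" and ?d = "dist w z"
    have "norm ((S w ?t - S z ?t) - (S w 0 - S z 0)) \<le> ?d / 2 * (exp (a * ?t) - 1)"
    proof (rule exp_weighted_mean_value[where f = "\<lambda>t. S w t - S z t" and f' = "\<lambda>t. g w t - g z t"])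
      show "0 \<le> ?t" using \<tau>[of t] by simp
      fix s assume s: "s \<in> {0..?t}"
      then have s': "s \<in> {0..T}" and sub: "{0..?t} \<subseteq> {0..T}" using \<tau>[of t] by auto
      show "((\<lambda>t. S w t - S z t) has_vector_derivative g w s - g z s) (at s within {0..?t})"
        by (intro has_vector_derivative_diff
            has_vector_derivative_within_subset[OF S_deriv[OF s'] sub])
      have "norm (g w s - g z s) \<le> K * norm (exp (a * s) *\<^sub>R w s - exp (a * s) *\<^sub>R z s)"
        unfolding g_def by (rule lipschitz_on_normD[OF G]) auto
      also have "\<dots> = K * (exp (a * s) * dist (w s) (z s))"
        by (simp add: dist_norm flip: scaleR_diff_right)
      also have "\<dots> \<le> (K + 1) * (exp (a * s) * ?d)"
        using K dist_bounded[of w s z] by (intro mult_mono) auto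
      finally show "norm (g w s - g z s) \<le> ?d / 2 * a * exp (a * s)"
        by (simp add: a_def algebra_simps)
    qed
    moreover have "S w 0 = S z 0" by (simp add: S_def)
    moreover have "?d / 2 * (exp (a * ?t) - 1) \<le> ?d / 2 * exp (a * ?t)"
      by (intro mult_left_mono) auto
    ultimately have "norm (S w ?t - S z ?t) \<le> ?d / 2 * exp (a * ?t)" by simp
    then have "exp (- a * ?t) * norm (S w ?t - S z ?t) \<le> exp (- a * ?t) * (?d / 2 * exp (a * ?t))"
      by (rule mult_left_mono) simp
    also have "\<dots> = 1/2 * ?d" by (simp add: exp_minus field_simps)
    finally show "dist (Bcontfun (H w) t) (Bcontfun (H z) t) \<le> 1/2 * ?d"
      unfolding Bcontfun_inverse[OF H] by (simp add: H_def dist_norm flip: scaleR_diff_right)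
  qed
  have "\<exists>!w. Bcontfun (H w) = w"
    by (rule banach_fix_type[of "1/2"]) (use contraction in auto)
  then obtain w where "Bcontfun (H w) = w" by blast
  then have w: "w t = H w t" for t using Bcontfun_inverse[OF H[of w]] by simp
  \<comment> \<open>At the fixed point \<open>exp (a * t) *\<^sub>R w t\<close> is
    \<open>S w t\<close>, so the integral equation for \<open>S w\<close> closes up.\<close>
  have g_eq: "g w t = G (S w t)" if "t \<in> {0..T}" for t
    by (simp add: g_def w H_def \<tau>_id[OF that] flip: exp_add)
  show ?thesis
  proof
    show "S w 0 = v0" by (simp add: S_def)
    show "(S w has_vector_derivative G (S w t)) (at t within {0..T})" if "t \<in> {0..T}" for t
      using S_deriv[OF that, of w] g_eq[OF that] by simp
  qed
qed

text \<open>With the integrating factor \<open>exp (\<mu> * t)\<close>, the vector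
  \<open>v t - c\<close> grows by at most \<open>r * (exp (\<mu> * t) - 1)\<close> from an initial
  norm of at most \<open>r\<close>; dividing by the factor leaves \<open>r\<close>.\<close>

lemma ode_stays_in_ball:
  fixes v :: "real \<Rightarrow> 'a::real_normed_vector"
  assumes v: "\<And>t. t \<in> {0..T} \<Longrightarrow> (v has_vector_derivative v' t) (at t within {0..T})"
    and le: "\<And>t. t \<in> {0..T} \<Longrightarrow> norm (v' t + \<mu> *\<^sub>R (v t - c)) \<le> \<mu> * r"
    and init: "norm (v 0 - c) \<le> r" and t: "t \<in> {0..T}"
  shows "norm (v t - c) \<le> r"
proof -
  have "norm (exp (\<mu> * t) *\<^sub>R (v t - c) - exp (\<mu> * 0) *\<^sub>R (v 0 - c)) \<le> r * (exp (\<mu> * t) - 1)"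
  proof (rule exp_weighted_mean_value[where f = "\<lambda>s. exp (\<mu> * s) *\<^sub>R (v s - c)" and
        f' = "\<lambda>s. exp (\<mu> * s) *\<^sub>R (v' s + \<mu> *\<^sub>R (v s - c))"])
    show "0 \<le> t" using t by simp
    fix s assume "s \<in> {0..t}"
    then have s: "s \<in> {0..T}" and sub: "{0..t} \<subseteq> {0..T}" using t by auto
    note v_s = has_vector_derivative_within_subset[OF v[OF s] sub]
    show "((\<lambda>s. exp (\<mu> * s) *\<^sub>R (v s - c)) has_vector_derivative
        exp (\<mu> * s) *\<^sub>R (v' s + \<mu> *\<^sub>R (v s - c))) (at s within {0..t})"
      by (rule derivative_eq_intros v_s refl)+ (simp add: algebra_simps)
    show "norm (exp (\<mu> * s) *\<^sub>R (v' s + \<mu> *\<^sub>R (v s - c))) \<le> r * \<mu> * exp (\<mu> * s)"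
      using le[OF s] by (simp add: mult.commute mult_right_mono)
  qed
  then have "norm (exp (\<mu> * t) *\<^sub>R (v t - c)) \<le> r * (exp (\<mu> * t) - 1) + norm (v 0 - c)"
    by (smt (verit) exp_zero mult_zero_right norm_triangle_sub scaleR_one)
  also have "\<dots> \<le> r * exp (\<mu> * t)" using init by (simp add: algebra_simps)
  finally show ?thesis by (simp add: mult.commute)
qed

section \<open>Pointwise calculus with representatives of classes in L^infinity\<close>

lemma linf_fun_borel_measurable [measurable]: "linf_fun u \<in> borel_measurable leb01"
  using linf_fun(1) by (simp add: ess_bounded_def)

lemma norm_linf_le_iff: "norm u \<le> C \<longleftrightarrow> (AE x in leb01. \<bar>linf_fun u x\<bar> \<le> C)"
  using norm_linf_le_iff_Linf[OF linf_fun(1), of u C] by (simp add: linf_fun(2))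

lemma linf_fun_add: "AE x in leb01. linf_fun (u + v) x = linf_fun u x + linf_fun v x"
proof -
  have "u + v = Linf (\<lambda>x. linf_fun u x + linf_fun v x)"
    using plus_linf.abs_eq[of "linf_fun u" "linf_fun v"] linf_fun by (simp add: linf_rel_def)
  then show ?thesis
    using linf_fun_Linf[OF ess_bounded_add[OF linf_fun(1) linf_fun(1)], of u v] by simp
qed

lemma linf_fun_diff: "AE x in leb01. linf_fun (u - v) x = linf_fun u x - linf_fun v x"
proof -
  have "u - v = Linf (\<lambda>x. linf_fun u x - linf_fun v x)"
    using minus_linf.abs_eq[of "linf_fun u" "linf_fun v"] linf_fun by (simp add: linf_rel_def)
  then show ?thesis
    using linf_fun_Linf[OF ess_bounded_diff[OF linf_fun(1) linf_fun(1)], of u v] by simp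
qed

lemma linf_fun_scaleR: "AE x in leb01. linf_fun (r *\<^sub>R u) x = r * linf_fun u x"
proof -
  have "r *\<^sub>R u = Linf (\<lambda>x. r * linf_fun u x)"
    using scaleR_linf.abs_eq[of "linf_fun u" r] linf_fun by (simp add: linf_rel_def)
  then show ?thesis
    using linf_fun_Linf[OF ess_bounded_scale[OF linf_fun(1)], of r u] by simp
qed

lemma norm_linf_diff_le_iff:
  "norm (u - v) \<le> C \<longleftrightarrow> (AE x in leb01. \<bar>linf_fun u x - linf_fun v x\<bar> \<le> C)"
  unfolding norm_linf_le_iff by (rule eventually_cong[OF linf_fun_diff[of u v]]) simp

lemma ess_bounded_const: "ess_bounded (\<lambda>_. c)"
  by (rule ess_boundedI[where C = "\<bar>c\<bar>"]) auto

text \<open>Translates order bounds by constants into membership in a closed ball, so that the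
  invariance result for balls applies to them.\<close>

lemma norm_diff_linf_const_le_iff:
  "norm (u - Linf (\<lambda>_. c)) \<le> r \<longleftrightarrow> (AE x in leb01. c - r \<le> linf_fun u x \<and> linf_fun u x \<le> c + r)"
  unfolding norm_linf_diff_le_iff
  by (rule eventually_cong[OF linf_fun_Linf[OF ess_bounded_const[of c]]]) auto

lemma linf_fun_reaction:
  assumes "\<forall>B. bounded B \<longrightarrow> (\<exists>K. K-lipschitz_on B \<phi>)"
  shows "AE x in leb01. linf_fun (reaction \<phi> u) x = \<phi> (linf_fun u x)"
proof -
  have "ess_bounded (\<lambda>x. \<phi> (linf_fun u x))"
    by (rule ess_bounded_reaction[OF _ linf_fun(1)]) (simp add: assms)
  then show ?thesis unfolding reaction_def by (rule linf_fun_Linf)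
qed

text \<open>Composition inherits the constant of \<open>\<phi>\<close> on any set \<open>S\<close>
  that contains almost all values. It is applied to the nonlinearity on bounded sets and to the
  truncation on the whole space.\<close>

lemma lipschitz_on_reaction:
  assumes loc: "\<forall>B. bounded B \<longrightarrow> (\<exists>K. K-lipschitz_on B \<phi>)"
    and K: "K-lipschitz_on S \<phi>"
    and S: "\<And>u. u \<in> A \<Longrightarrow> AE x in leb01. linf_fun u x \<in> S"
  shows "K-lipschitz_on A (reaction \<phi>)"
proof (rule lipschitz_onI)
  show "0 \<le> K" using K by (rule lipschitz_on_nonneg)
  fix u v assume "u \<in> A" "v \<in> A"
  have "AE x in leb01. \<bar>linf_fun u x - linf_fun v x\<bar> \<le> norm (u - v)"
    using norm_linf_diff_le_iff by blast
  then have "AE x in leb01. \<bar>linf_fun (reaction \<phi> u) x - linf_fun (reaction \<phi> v) x\<bar> \<le> K * norm (u - v)"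
    using S[OF \<open>u \<in> A\<close>] S[OF \<open>v \<in> A\<close>] linf_fun_reaction[OF loc, of u] linf_fun_reaction[OF loc, of v]
  proof eventually_elim
    case (elim x)
    then have "\<bar>\<phi> (linf_fun u x) - \<phi> (linf_fun v x)\<bar> \<le> K * \<bar>linf_fun u x - linf_fun v x\<bar>"
      using lipschitz_on_normD[OF K, of "linf_fun u x" "linf_fun v x"] by simp
    also have "\<dots> \<le> K * norm (u - v)"
      using elim \<open>0 \<le> K\<close> by (intro mult_left_mono) auto
    finally show ?case using elim by simp
  qed
  then show "dist (reaction \<phi> u) (reaction \<phi> v) \<le> K * dist u v"
    by (simp add: dist_norm norm_linf_diff_le_iff)
qed

section \<open>Sections of the kernel and bounds for its averages\<close>

text \<open>The degree bound alone does not give this, since a non-integrable section has integral 0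
  by default. Fubini is applied to a Borel version \<open>g'\<close> of the kernel, which agrees
  with it on almost every section up to null sets.\<close>

lemma AE_integrable_section_leb01:
  fixes W :: "real \<Rightarrow> real \<Rightarrow> real"
  assumes W: "integrable (lebesgue_on ({0<..<1} \<times> {0<..<1})) (\<lambda>(x, y). W x y)"
  shows "AE x in leb01. integrable leb01 (W x)"
proof -
  let ?I = "{0<..<1::real}"
  define g where "g = (\<lambda>p. indicator (?I \<times> ?I) p * W (fst p) (snd p))"
  have "integrable lebesgue g"
    using W unfolding g_def
    by (subst (asm) integrable_restrict_space) (auto simp: case_prod_unfold borel_open open_Times intro!: sets_completionI_sets)
  then have g_int: "integrable (completion lborel) g" .
  then obtain g' where g': "g' \<in> borel_measurable lborel" "AE p in lborel. g p = g' p"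
    using completion_ex_borel_measurable_real[of g lborel] by auto
  have "integrable (completion lborel) g'"
    using g' by (intro integrable_cong_AE_imp[OF g_int] AE_completion measurable_completion) auto
  then have g'_int: "integrable (lborel \<Otimes>\<^sub>M lborel) g'"
    using g'(1) by (simp add: integrable_completion lborel_prod)
  have "AE x in lborel. AE y in lborel. g (x, y) = g' (x, y)"
    using g'(2) unfolding lborel_prod[symmetric] by (rule lborel_pair.AE_pair)
  moreover have "AE x in lborel. integrable lborel (\<lambda>y. g' (x, y))"
    by (rule lborel_pair.AE_integrable_fst'[OF g'_int])
  ultimately have "AE x in lborel. x \<in> ?I \<longrightarrow> integrable leb01 (W x)"
  proof eventually_elim
    case (elim x)
    show ?case
    proof
      assume x: "x \<in> ?I"
      have int: "integrable lebesgue (\<lambda>y. g' (x, y))"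
        using elim(2) by (simp add: integrable_completion)
      have eq: "AE y in lebesgue. g' (x, y) = indicator ?I y *\<^sub>R W x y"
        using elim(1) by (intro AE_completion) (use x in \<open>auto simp: g_def indicator_def elim!: eventually_mono\<close>)
      have "(\<lambda>y. indicator ?I y *\<^sub>R W x y) \<in> borel_measurable lebesgue"
        using int by (intro borel_measurable_AE[OF _ eq]) simp
      then have "integrable lebesgue (\<lambda>y. indicator ?I y *\<^sub>R W x y)"
        using eq by (rule integrable_cong_AE_imp[OF int])
      then show "integrable leb01 (W x)"
        by (subst integrable_restrict_space) auto
    qed
  qed
  then show ?thesis by (simp add: AE_leb01)
qed

text \<open>The values \<open>f y - a\<close> lie between \<open>A - a\<close> and
  \<open>B - a\<close>, an interval containing 0; averaging with a nonnegative weight of total mass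
  at most 1 therefore stays inside it.\<close>

lemma
  fixes k f :: "'a \<Rightarrow> real"
  assumes k: "integrable M k" "AE y in M. 0 \<le> k y" "(LINT y|M. k y) \<le> 1"
    and f: "f \<in> borel_measurable M" "AE y in M. A \<le> f y \<and> f y \<le> B"
    and a: "A \<le> a" "a \<le> B"
  shows integrable_kernel_mult_diff: "integrable M (\<lambda>y. k y * (f y - a))"
    and kernel_mult_diff_ge: "A - a \<le> (LINT y|M. k y * (f y - a))"
    and kernel_mult_diff_le: "(LINT y|M. k y * (f y - a)) \<le> B - a"
proof -
  have bound: "AE y in M. norm (k y * (f y - a)) \<le> norm ((B - A) * k y)"
    using k(2) f(2)
  proof eventually_elim
    case (elim y)
    then have "k y * \<bar>f y - a\<bar> \<le> k y * (B - A)" using a by (intro mult_left_mono) auto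
    then show ?case using elim a by (simp add: abs_mult mult.commute)
  qed
  have "(\<lambda>y. k y * (f y - a)) \<in> borel_measurable M"
    using k(1) f(1) by measurable
  then show int: "integrable M (\<lambda>y. k y * (f y - a))"
    by (rule Bochner_Integration.integrable_bound[rotated, OF _ bound]) (simp add: k(1))
  have "AE y in M. k y * (f y - a) \<le> k y * (B - a)"
    using k(2) f(2) by eventually_elim (simp add: mult_left_mono)
  then have "(LINT y|M. k y * (f y - a)) \<le> (LINT y|M. k y * (B - a))"
    using k(1) by (intro integral_mono_AE int) auto
  also have "\<dots> = (LINT y|M. k y) * (B - a)" by simp
  also have "\<dots> \<le> 1 * (B - a)" using k a by (intro mult_right_mono) auto
  finally show "(LINT y|M. k y * (f y - a)) \<le> B - a" by simp
  have "AE y in M. k y * (A - a) \<le> k y * (f y - a)"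
    using k(2) f(2) by eventually_elim (simp add: mult_left_mono)
  then have *: "(LINT y|M. k y * (A - a)) \<le> (LINT y|M. k y * (f y - a))"
    using k(1) by (intro integral_mono_AE int) auto
  have "1 * (A - a) \<le> (LINT y|M. k y) * (A - a)" using k a by (intro mult_right_mono_neg) auto
  also have "\<dots> = (LINT y|M. k y * (A - a))" by simp
  also note *
  finally show "A - a \<le> (LINT y|M. k y * (f y - a))" by simp
qed

text \<open>Adding the shift \<open>\<mu> * (w - (M1 + M2) / 2)\<close> to both one-sided bounds
  makes them symmetric around 0.\<close>

lemma abs_add_mult_midpoint_le:
  fixes e \<mu> w M1 M2 :: real
  assumes "\<mu> * (M1 - w) \<le> e" "e \<le> \<mu> * (M2 - w)"
  shows "\<bar>e + \<mu> * (w - (M1 + M2) / 2)\<bar> \<le> \<mu> * ((M2 - M1) / 2)"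
proof -
  have "(M2 - w) + (w - (M1 + M2) / 2) = (M2 - M1) / 2" "(M1 - w) + (w - (M1 + M2) / 2) = - ((M2 - M1) / 2)"
    by argo+
  then have "\<mu> * (M2 - w) + \<mu> * (w - (M1 + M2) / 2) = \<mu> * ((M2 - M1) / 2)"
    "\<mu> * (M1 - w) + \<mu> * (w - (M1 + M2) / 2) = - (\<mu> * ((M2 - M1) / 2))"
    unfolding distrib_left[symmetric] by (simp_all only: mult_minus_right)
  with add_right_mono[OF assms(1), of "\<mu> * (w - (M1 + M2) / 2)"]
    add_right_mono[OF assms(2), of "\<mu> * (w - (M1 + M2) / 2)"]
  show ?thesis unfolding abs_le_iff by (metis neg_le_iff_le minus_minus)
qed

section \<open>The graphon vector field: Lipschitz bounds, uniqueness and invariance\<close>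

locale graphon_reaction =
  fixes W :: "real \<Rightarrow> real \<Rightarrow> real" and \<Phi> :: "real \<Rightarrow> real"
  assumes W_L1: "integrable (lebesgue_on ({0<..<1} \<times> {0<..<1})) (\<lambda>(x, y). W x y)"
    and W_nonneg: "\<And>x y. x \<in> {0<..<1} \<Longrightarrow> y \<in> {0<..<1} \<Longrightarrow> 0 \<le> W x y"
    and W_degree: "AE x in leb01. (LINT y|leb01. W x y) \<le> 1"
    and Phi_lipschitz: "\<And>B. bounded B \<Longrightarrow> \<exists>K. K-lipschitz_on B \<Phi>"
begin

definition field :: "linf \<Rightarrow> linf"
  where "field u = graphon_diffusion W u + reaction \<Phi> u"

lemma Phi_locally_lipschitz: "\<forall>B. bounded B \<longrightarrow> (\<exists>K. K-lipschitz_on B \<Phi>)"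
  using Phi_lipschitz by blast

lemma AE_kernel:
  "AE x in leb01. integrable leb01 (W x) \<and> (AE y in leb01. 0 \<le> W x y) \<and> (LINT y|leb01. W x y) \<le> 1"
proof -
  have "AE x in leb01. x \<in> space leb01" by (rule AE_space)
  then show ?thesis
    using AE_integrable_section_leb01[OF W_L1] W_degree
    by eventually_elim (auto simp: W_nonneg intro!: AE_I2)
qed

lemma linf_fun_graphon_diffusion:
  "AE x in leb01. linf_fun (graphon_diffusion W u) x = (LINT y|leb01. W x y * (linf_fun u y - linf_fun u x))"
  unfolding graphon_diffusion_def
  by (intro linf_fun_Linf ess_bounded_graphon_diffusion W_L1 W_nonneg W_degree linf_fun(1))

lemma linf_fun_field:
  "AE x in leb01. linf_fun (field u) x =
    (LINT y|leb01. W x y * (linf_fun u y - linf_fun u x)) + \<Phi> (linf_fun u x)"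
  using linf_fun_graphon_diffusion[of u] linf_fun_reaction[OF Phi_locally_lipschitz, of u]
    linf_fun_add[of "graphon_diffusion W u" "reaction \<Phi> u"]
  unfolding field_def by eventually_elim simp

text \<open>By linearity only \<open>h = u - v\<close> matters. With \<open>n\<close> its norm, the
  average of \<open>h y - h x\<close> lies between \<open>- n - h x\<close> and
  \<open>n - h x\<close>, and \<open>h x\<close> itself is at most \<open>n\<close> in absolute
  value, hence the constant 2.\<close>

lemma lipschitz_on_graphon_diffusion: "2-lipschitz_on A (graphon_diffusion W)"
proof (rule lipschitz_onI)
  fix u v :: linf
  let ?n = "norm (u - v)"
  have AE_le: "AE x in leb01. \<bar>linf_fun w x\<bar> \<le> norm w" for w
    using norm_linf_le_iff by blast
  have d: "AE x in leb01. \<bar>linf_fun u x - linf_fun v x\<bar> \<le> ?n"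
    using norm_linf_diff_le_iff by blast
  have "AE x in leb01. \<bar>linf_fun (graphon_diffusion W u) x - linf_fun (graphon_diffusion W v) x\<bar> \<le> 2 * ?n"
    using AE_kernel linf_fun_graphon_diffusion[of u] linf_fun_graphon_diffusion[of v] d AE_le[of u] AE_le[of v]
  proof eventually_elim
    case (elim x)
    \<comment> \<open>Integrability of both integrands is what allows the integral of the difference
      to be split.\<close>
    have int: "integrable leb01 (\<lambda>y. W x y * (linf_fun w y - linf_fun w x))"
      if "\<bar>linf_fun w x\<bar> \<le> norm w" for w
    proof (rule integrable_kernel_mult_diff[where A = "- norm w" and B = "norm w"])
      show "AE y in leb01. - norm w \<le> linf_fun w y \<and> linf_fun w y \<le> norm w"
        using AE_le[of w] by eventually_elim auto
    qed (use elim(1) that in auto)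
    let ?h = "\<lambda>y. linf_fun u y - linf_fun v y"
    have "(LINT y|leb01. W x y * (?h y - ?h x)) =
      (LINT y|leb01. W x y * (linf_fun u y - linf_fun u x) - W x y * (linf_fun v y - linf_fun v x))"
      by (simp add: algebra_simps)
    also have "\<dots> = linf_fun (graphon_diffusion W u) x - linf_fun (graphon_diffusion W v) x"
      using int[OF elim(5)] int[OF elim(6)] elim(2,3) by simp
    finally have eq: "linf_fun (graphon_diffusion W u) x - linf_fun (graphon_diffusion W v) x =
      (LINT y|leb01. W x y * (?h y - ?h x))" by simp
    have ae: "AE y in leb01. - ?n \<le> ?h y \<and> ?h y \<le> ?n"
      using d by eventually_elim auto
    have "- ?n - ?h x \<le> (LINT y|leb01. W x y * (?h y - ?h x))"
      "(LINT y|leb01. W x y * (?h y - ?h x)) \<le> ?n - ?h x"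
      using elim(1,4) ae by (auto intro!: kernel_mult_diff_ge[where B = ?n] kernel_mult_diff_le[where A = "- ?n"])
    then show ?case unfolding eq using elim(4) by linarith
  qed
  then show "dist (graphon_diffusion W u) (graphon_diffusion W v) \<le> 2 * dist u v"
    by (simp add: dist_norm norm_linf_diff_le_iff)
qed simp

lemma lipschitz_on_field:
  assumes "bounded A"
  obtains K where "K-lipschitz_on A field"
proof -
  obtain R where R: "\<And>u. u \<in> A \<Longrightarrow> norm u \<le> R" using assms by (auto simp: bounded_iff)
  obtain K where K: "K-lipschitz_on {-R..R} \<Phi>" using Phi_lipschitz[of "{-R..R}"] by auto
  have "K-lipschitz_on A (reaction \<Phi>)"
    using Phi_locally_lipschitz K
  proof (rule lipschitz_on_reaction)
    fix u assume "u \<in> A"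
    then have "AE x in leb01. \<bar>linf_fun u x\<bar> \<le> R" using R norm_linf_le_iff by blast
    then show "AE x in leb01. linf_fun u x \<in> {-R..R}" by eventually_elim auto
  qed
  then have "(2 + K)-lipschitz_on A field"
    unfolding field_def by (intro lipschitz_on_add lipschitz_on_graphon_diffusion)
  then show ?thesis by (rule that)
qed

text \<open>Both solutions have compact images on \<open>{0..T}\<close>, so one Lipschitz constant
  of \<open>field\<close> serves on their union and the uniqueness result for Lipschitz equations
  applies.\<close>

lemma classical_solution_unique:
  assumes v: "classical_solution W \<Phi> {0..T} v" and w: "classical_solution W \<Phi> {0..T} w"
    and init: "v 0 = w 0" and t: "t \<in> {0..T}"
  shows "v t = w t"
proof -
  have deriv: "(z has_vector_derivative field (z t)) (at t within {0..T})"
    if "classical_solution W \<Phi> {0..T} z" "t \<in> {0..T}" for z t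
    using that unfolding classical_solution_def field_def by metis
  have "bounded (z ` {0..T})" if "classical_solution W \<Phi> {0..T} z" for z
    using deriv[OF that]
    by (intro compact_imp_bounded compact_continuous_image continuous_on_vector_derivative) auto
  then have "bounded (v ` {0..T} \<union> w ` {0..T})" using v w by simp
  then obtain K where "K-lipschitz_on (v ` {0..T} \<union> w ` {0..T}) field"
    by (rule lipschitz_on_field)
  then show ?thesis
    using deriv[OF v] deriv[OF w] by (rule lipschitz_ode_unique) (use init t in auto)
qed

text \<open>
  The order interval from \<^term>\<open>M1\<close> to \<^term>\<open>M2\<close> is the ball of \<^typ>\<open>linf\<close> around a constant
  function. A valid \<^term>\<open>\<mu>\<close> is one plus a Lipschitz constant of the nonlinearity on it.
\<close>

lemma field_inward:
  assumes M: "M1 < M2" "\<Phi> M2 \<le> 0" "0 \<le> \<Phi> M1"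
  defines "c \<equiv> Linf (\<lambda>_. (M1 + M2) / 2)" and "r \<equiv> (M2 - M1) / 2"
  obtains \<mu> where "\<And>w. norm (w - c) \<le> r \<Longrightarrow> norm (field w + \<mu> *\<^sub>R (w - c)) \<le> \<mu> * r"
proof -
  obtain K where K: "K-lipschitz_on {M1..M2} \<Phi>" using Phi_lipschitz[of "{M1..M2}"] by auto
  define \<mu> where "\<mu> = 1 + K"
  have "norm (field w + \<mu> *\<^sub>R (w - c)) \<le> \<mu> * r" if w: "norm (w - c) \<le> r" for w
  proof -
    have M_r: "(M1 + M2) / 2 - r = M1" "(M1 + M2) / 2 + r = M2"
      by (simp_all add: r_def field_simps)
    have w_AE: "AE x in leb01. M1 \<le> linf_fun w x \<and> linf_fun w x \<le> M2"
      using w unfolding c_def norm_diff_linf_const_le_iff M_r .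
    have "AE x in leb01. \<bar>linf_fun (field w + \<mu> *\<^sub>R (w - c)) x\<bar> \<le> \<mu> * r"
      using AE_kernel w_AE linf_fun_field[of w] linf_fun_add[of "field w" "\<mu> *\<^sub>R (w - c)"]
        linf_fun_scaleR[of \<mu> "w - c"] linf_fun_diff[of w c]
        linf_fun_Linf[OF ess_bounded_const[of "(M1 + M2) / 2"], folded c_def]
    proof eventually_elim
      case (elim x)
      let ?w = "linf_fun w x"
      let ?D = "LINT y|leb01. W x y * (linf_fun w y - ?w)"
      have D: "M1 - ?w \<le> ?D" "?D \<le> M2 - ?w"
        using elim(1,2) w_AE
        by (auto intro!: kernel_mult_diff_ge[where B = M2] kernel_mult_diff_le[where A = M1])
      have "\<bar>\<Phi> ?w - \<Phi> M1\<bar> \<le> K * (?w - M1)" "\<bar>\<Phi> ?w - \<Phi> M2\<bar> \<le> K * (M2 - ?w)"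
        using lipschitz_on_normD[OF K, of ?w M1] lipschitz_on_normD[OF K, of ?w M2] elim(2) M(1)
        by auto
      \<comment> \<open>The signs of \<open>\<Phi>\<close> at the ends enter here: dropping
        \<open>\<Phi> M1\<close> and \<open>\<Phi> M2\<close> only weakens the bounds. With the
        average contributing 1 and the reaction \<open>K\<close>, the sum has slope
        \<open>\<mu> = 1 + K\<close>.\<close>
      then have "K * (M1 - ?w) \<le> \<Phi> ?w" "\<Phi> ?w \<le> K * (M2 - ?w)"
        using M by (auto simp: algebra_simps)
      with D have "\<mu> * (M1 - ?w) \<le> ?D + \<Phi> ?w" "?D + \<Phi> ?w \<le> \<mu> * (M2 - ?w)"
        by (auto simp: \<mu>_def algebra_simps)
      moreover have "linf_fun (field w + \<mu> *\<^sub>R (w - c)) x = ?D + \<Phi> ?w + \<mu> * (?w - (M1 + M2) / 2)"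
        using elim(3-) by simp
      ultimately show ?case
        unfolding r_def by (simp only: abs_add_mult_midpoint_le)
    qed
    then show ?thesis by (simp add: norm_linf_le_iff)
  qed
  then show ?thesis by (rule that)
qed

text \<open>Existence and bounds come together for every \<open>T\<close>: the truncated equation is
  solvable globally, and truncation never acts on its solution. No blow-up criterion enters.\<close>

lemma invariant_classical_solution_exists:
  assumes M: "M1 < M2" "\<Phi> M2 \<le> 0" "0 \<le> \<Phi> M1"
    and u0: "AE x in leb01. M1 \<le> linf_fun u0 x \<and> linf_fun u0 x \<le> M2" and "0 \<le> T"
  obtains v where "classical_solution W \<Phi> {0..T} v" "v 0 = u0"
    and "\<And>t. t \<in> {0..T} \<Longrightarrow> AE x in leb01. M1 \<le> linf_fun (v t) x \<and> linf_fun (v t) x \<le> M2"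
proof -
  define c where "c = Linf (\<lambda>_. (M1 + M2) / 2)"
  define r where "r = (M2 - M1) / 2"
  have M_r: "(M1 + M2) / 2 - r = M1" "(M1 + M2) / 2 + r = M2"
    by (simp_all add: r_def field_simps)
  have ball_iff: "norm (w - c) \<le> r \<longleftrightarrow> (AE x in leb01. M1 \<le> linf_fun w x \<and> linf_fun w x \<le> M2)" for w
    unfolding c_def norm_diff_linf_const_le_iff M_r ..
  obtain \<mu> where inward: "\<And>w. norm (w - c) \<le> r \<Longrightarrow> norm (field w + \<mu> *\<^sub>R (w - c)) \<le> \<mu> * r"
    by (rule field_inward[OF M, folded c_def r_def]) blast
  define \<kappa> where "\<kappa> = (\<lambda>a. max M1 (min M2 a))"
  have \<kappa>: "1-lipschitz_on S \<kappa>" for S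
    by (rule lipschitz_onI) (auto simp: \<kappa>_def dist_real_def)
  then have \<kappa>_loc: "\<forall>B. bounded B \<longrightarrow> (\<exists>K. K-lipschitz_on B \<kappa>)" by blast
  \<comment> \<open>As \<open>reaction\<close> is composition with a scalar function, it also
    provides the pointwise truncation.\<close>
  define P where "P = reaction \<kappa>"
  have P_lip: "1-lipschitz_on UNIV P"
    unfolding P_def by (rule lipschitz_on_reaction[OF \<kappa>_loc \<kappa>[of UNIV]]) auto
  have P_ball: "norm (P w - c) \<le> r" for w
    unfolding ball_iff P_def using linf_fun_reaction[OF \<kappa>_loc, of w]
    by eventually_elim (use M(1) in \<open>auto simp: \<kappa>_def\<close>)
  have P_id: "P w = w" if "norm (w - c) \<le> r" for w
  proof -
    have "AE x in leb01. \<bar>linf_fun (P w) x - linf_fun w x\<bar> \<le> 0"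
      using that linf_fun_reaction[OF \<kappa>_loc, of w] unfolding ball_iff P_def
      by eventually_elim (auto simp: \<kappa>_def)
    then have "norm (P w - w) \<le> 0" by (simp only: norm_linf_diff_le_iff)
    then show ?thesis by simp
  qed
  have "bounded {w. norm (w - c) \<le> r}"
    by (rule bounded_subset[OF bounded_cball[of c r]]) (auto simp: dist_norm norm_minus_commute)
  then obtain K where K: "K-lipschitz_on {w. norm (w - c) \<le> r} field"
    by (rule lipschitz_on_field)
  \<comment> \<open>The term \<open>- \<mu> w\<close> is left untruncated, so that
    \<open>G w + \<mu> (w - c)\<close> equals \<open>field (P w) + \<mu> (P w - c)\<close>. The
    inward bound at \<open>P w\<close> then holds for every \<open>w\<close>, before it is known
    that the solution stays in the ball.\<close>
  define G where "G = (\<lambda>w. (- \<mu>) *\<^sub>R w + \<mu> *\<^sub>R P w + field (P w))"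
  \<comment> \<open>All values of \<open>P\<close> lie in the ball, where \<open>field\<close> has a
    single Lipschitz constant; this makes \<open>G\<close> globally Lipschitz.\<close>
  have "K-lipschitz_on (P ` UNIV) field"
    by (rule lipschitz_on_subset[OF K]) (use P_ball in auto)
  then have "(\<bar>- \<mu>\<bar> * 1 + \<bar>\<mu>\<bar> * 1 + K * 1)-lipschitz_on UNIV G"
    unfolding G_def
    by (intro lipschitz_on_add lipschitz_on_cmult lipschitz_on_id lipschitz_on_compose2 P_lip)
  then obtain v where v0: "v 0 = u0"
    and v: "\<And>t. t \<in> {0..T} \<Longrightarrow> (v has_vector_derivative G (v t)) (at t within {0..T})"
    using lipschitz_ode_exists[OF _ \<open>0 \<le> T\<close>] by blast
  have v_ball: "norm (v t - c) \<le> r" if "t \<in> {0..T}" for t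
  proof (rule ode_stays_in_ball[OF v _ _ that])
    show "norm (G (v t) + \<mu> *\<^sub>R (v t - c)) \<le> \<mu> * r" for t
      using inward[OF P_ball[of "v t"]] by (simp add: G_def algebra_simps)
    show "norm (v 0 - c) \<le> r" using u0 v0 by (simp add: ball_iff)
  qed
  have G_eq: "G (v t) = field (v t)" if "t \<in> {0..T}" for t
    using P_id[OF v_ball[OF that]] by (simp add: G_def)
  have "classical_solution W \<Phi> {0..T} v"
    unfolding classical_solution_def
  proof (intro exI[of _ "\<lambda>t. field (v t)"] conjI ballI)
    show "continuous_on {0..T} (\<lambda>t. field (v t))"
      by (rule continuous_on_compose2[OF lipschitz_on_continuous_on[OF K]])
        (use v_ball continuous_on_vector_derivative[OF v] in auto)
  qed (use v G_eq in \<open>auto simp: field_def\<close>)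
  then show ?thesis using v0 v_ball by (intro that[of v]) (auto simp: ball_iff)
qed

end

section \<open>Transfer to the given solution\<close>

lemma classical_solution_subset:
  assumes "classical_solution W \<Phi> J u" "I \<subseteq> J"
  shows "classical_solution W \<Phi> I u"
proof -
  from assms(1) obtain u' where u': "continuous_on J u'"
    and deriv: "\<And>t. t \<in> J \<Longrightarrow> (u has_vector_derivative u' t) (at t within J)"
    and eq: "\<And>t. t \<in> J \<Longrightarrow> u' t = graphon_diffusion W (u t) + reaction \<Phi> (u t)"
    unfolding classical_solution_def by blast
  show ?thesis
    unfolding classical_solution_def
  proof (intro exI[of _ u'] conjI ballI)
    show "continuous_on I u'" using u' assms(2) by (rule continuous_on_subset)
    show "(u has_vector_derivative u' t) (at t within I)" if "t \<in> I" for t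
      using that assms(2) by (intro has_vector_derivative_within_subset[OF deriv]) auto
    show "u' t = graphon_diffusion W (u t) + reaction \<Phi> (u t)" if "t \<in> I" for t
      using that assms(2) by (intro eq) auto
  qed
qed

theorem theorem3p9:
  fixes W :: "real \<Rightarrow> real \<Rightarrow> real" and \<Phi> :: "real \<Rightarrow> real" and M1 M2 :: real
    and u0 :: linf and u :: "real \<Rightarrow> linf" and T_max :: ereal
  assumes W_L1: "integrable (lebesgue_on ({0<..<1} \<times> {0<..<1})) (\<lambda>(x, y). W x y)"
    and W_sym: "\<And>x y. x \<in> {0<..<1} \<Longrightarrow> y \<in> {0<..<1} \<Longrightarrow> W x y = W y x"
    and W_nonneg: "\<And>x y. x \<in> {0<..<1} \<Longrightarrow> y \<in> {0<..<1} \<Longrightarrow> 0 \<le> W x y"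
    and W_degree: "AE x in lebesgue_on {0<..<1}. (LINT y|lebesgue_on {0<..<1}. W x y) \<le> 1"
    and Phi_0: "\<Phi> 0 = 0"
    and Phi_lipschitz: "\<And>B. bounded B \<Longrightarrow> \<exists>K. K-lipschitz_on B \<Phi>"
    and M: "M1 < M2" "\<Phi> M2 \<le> 0" "0 \<le> \<Phi> M1"
    and T_max: "T_max = existence_time W \<Phi> u0"
    and u: "classical_solution W \<Phi> {t. 0 \<le> t \<and> ereal t < T_max} u" "u 0 = u0"
    and u0: "AE x in lebesgue_on {0<..<1}. M1 \<le> linf_fun u0 x \<and> linf_fun u0 x \<le> M2"
  shows "(\<forall>t. 0 \<le> t \<and> ereal t < T_max \<longrightarrow>
      (AE x in lebesgue_on {0<..<1}. M1 \<le> linf_fun (u t) x \<and> linf_fun (u t) x \<le> M2)) \<and>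
    (\<forall>T>0. \<exists>v. classical_solution W \<Phi> {0..T} v \<and> v 0 = u0 \<and>
      (\<forall>t\<in>{0..T}. ereal t < T_max \<longrightarrow> v t = u t) \<and>
      (\<forall>w. classical_solution W \<Phi> {0..T} w \<and> w 0 = u0 \<longrightarrow> (\<forall>t\<in>{0..T}. w t = v t)))"
proof -
  interpret graphon_reaction W \<Phi>
    by standard (fact W_L1 W_nonneg W_degree Phi_lipschitz)+
  \<comment> \<open>The comparison runs on \<open>{0..t}\<close>, which lies in both domains even
    when \<open>T\<close> exceeds \<open>T_max\<close>.\<close>
  have u_eq: "v t = u t"
    if v: "classical_solution W \<Phi> {0..T} v" "v 0 = u0" and t: "t \<in> {0..T}" "ereal t < T_max" for v t T
  proof (rule classical_solution_unique)
    show "classical_solution W \<Phi> {0..t} v"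
      using t by (intro classical_solution_subset[OF v(1)]) auto
    have "{0..t} \<subseteq> {s. 0 \<le> s \<and> ereal s < T_max}"
      using t(2) by (auto intro: le_less_trans[of _ "ereal t"])
    then show "classical_solution W \<Phi> {0..t} u" by (rule classical_solution_subset[OF u(1)])
  qed (use v u t in auto)
  show ?thesis
  proof (intro conjI allI impI; (elim conjE)?)
    fix t assume t: "0 \<le> t" "ereal t < T_max"
    \<comment> \<open>The invariant solution on \<open>{0..t}\<close> agrees with \<open>u\<close>
      at its right end point \<open>t\<close>, which carries the bounds over.\<close>
    obtain v where v: "classical_solution W \<Phi> {0..t} v" "v 0 = u0"
      and v_bd: "\<And>s. s \<in> {0..t} \<Longrightarrow> AE x in leb01. M1 \<le> linf_fun (v s) x \<and> linf_fun (v s) x \<le> M2"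
      by (rule invariant_classical_solution_exists[OF M u0 t(1)]) blast
    show "AE x in leb01. M1 \<le> linf_fun (u t) x \<and> linf_fun (u t) x \<le> M2"
      using v_bd[of t] u_eq[OF v, of t] t by simp
  next
    fix T :: real assume "0 < T"
    then obtain v where v: "classical_solution W \<Phi> {0..T} v" "v 0 = u0"
      using invariant_classical_solution_exists[OF M u0 less_imp_le] by blast
    show "\<exists>v. classical_solution W \<Phi> {0..T} v \<and> v 0 = u0 \<and>
      (\<forall>t\<in>{0..T}. ereal t < T_max \<longrightarrow> v t = u t) \<and>
      (\<forall>w. classical_solution W \<Phi> {0..T} w \<and> w 0 = u0 \<longrightarrow> (\<forall>t\<in>{0..T}. w t = v t))"
    proof (intro exI[of _ v] conjI allI impI ballI; (elim conjE)?)
      show "w t = v t" if "classical_solution W \<Phi> {0..T} w" "w 0 = u0" "t \<in> {0..T}" for w t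
        using classical_solution_unique[OF that(1) v(1) _ that(3)] that(2) v(2) by simp
    qed (use v u_eq[OF v] in simp_all)
  qed
qed

end
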